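(* Let $\varphi:\mathbb{R}\to\mathbb{R}_+$ be a nonnegative convex function with linear growth, let $s_0>0$, $r\in\mathbb{R}$, and let $W$ be a standard Brownian motion. For $\sigma>0$ and $T>0$ set $S_t=s_0e^{(r-\frac{\sigma^2}{2})t+\sigma W_t}$, $t\in[0,T]$, and $$\mathrm{Premium}_0(s_0,\sigma,r,T)=e^{-rT}\,\mathbb{E}\,\varphi\Big(\frac1T\int_0^TS_s\,ds\Big).$$ Then $\sigma\mapsto\mathrm{Premium}_0(s_0,\sigma,r,T)$ is non-decreasing on $(0,+\infty)$. Moreover, when $r=0$, $T\mapsto\mathrm{Premium}_0(s_0,\sigma,0,T)$ is non-decreasing on $(0,+\infty)$.
   Context: "Linear growth" means $|\varphi(x)|\le C(1+|x|)$ for some real constant $C$. *)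

theory Defs
  imports "HOL-Probability.Probability"
begin

text \<open>Every path is required to be continuous on the half-line, rather than almost every path, so
  that pathwise time integrals are measurable without assuming that the measure is complete. The
  values of the process at negative times are irrelevant.\<close>

locale standard_brownian_motion = prob_space M
  for M :: "'a measure" and W :: "real \<Rightarrow> 'a \<Rightarrow> real" +
  assumes measurable: "\<And>t. 0 \<le> t \<Longrightarrow> W t \<in> borel_measurable M"
    and start: "AE \<omega> in M. W 0 \<omega> = 0"
    and independent_increments:
      "\<And>(n::nat) t. 0 \<le> t 0 \<Longrightarrow> (\<And>i. i < n \<Longrightarrow> t i < t (Suc i)) \<Longrightarrow>
         indep_vars (\<lambda>_. borel) (\<lambda>i \<omega>. W (t (Suc i)) \<omega> - W (t i) \<omega>) {..<n}"
    and gaussian_increments: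
      "\<And>s t. 0 \<le> s \<Longrightarrow> s < t \<Longrightarrow>
         distributed M lborel (\<lambda>\<omega>. W t \<omega> - W s \<omega>) (normal_density 0 (sqrt (t - s)))"
    and continuous_paths: "\<And>\<omega>. \<omega> \<in> space M \<Longrightarrow> continuous_on {0..} (\<lambda>t. W t \<omega>)"

definition linear_growth :: "(real \<Rightarrow> real) \<Rightarrow> bool" where
  "linear_growth \<phi> \<longleftrightarrow> (\<exists>C. \<forall>x. \<bar>\<phi> x\<bar> \<le> C * (1 + \<bar>x\<bar>))"

definition black_scholes ::
    "(real \<Rightarrow> 'a \<Rightarrow> real) \<Rightarrow> real \<Rightarrow> real \<Rightarrow> real \<Rightarrow> real \<Rightarrow> 'a \<Rightarrow> real" where
  "black_scholes W s0 \<sigma> r t \<omega> = s0 * exp ((r - \<sigma>\<^sup>2 / 2) * t + \<sigma> * W t \<omega>)"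

definition premium ::
    "'a measure \<Rightarrow> (real \<Rightarrow> 'a \<Rightarrow> real) \<Rightarrow> (real \<Rightarrow> real) \<Rightarrow> real \<Rightarrow> real \<Rightarrow> real \<Rightarrow> real \<Rightarrow> real" where
  "premium M W \<phi> s0 \<sigma> r T =
     exp (- r * T) *
       (\<integral>\<omega>. \<phi> (1 / T * (LBINT s:{0..T}. black_scholes W s0 \<sigma> r s \<omega>)) \<partial>M)"

end

(* Replace the time average by its right Riemann sum with n steps of length h = T/n. The payoff is
   then a function of the increments of sigma * W, which are independent centred Gaussians of
   variance v = sigma^2 * T / n, so the discrete premium depends on sigma (and, for r = 0, on T) only
   through v. Raising v to v + w amounts to adding independent Gaussians of variance w, which
   multiplies each summand by an independent factor of mean one; conditional Jensen then shows that
   the discrete premium is non-decreasing in v. The linear growth of phi and second moment bounds on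
   the price yield convergence of the discrete premiums to the continuous one. *)

theory Submission
  imports Defs
begin

section \<open>Gaussian product measures\<close>

text \<open>The Gaussian law is parametrised by its variance, so that parameters add under convolution.\<close>

definition gauss :: "real \<Rightarrow> real measure" where
  "gauss v = density lborel (\<lambda>x. ennreal (normal_density 0 (sqrt v) x))"

lemma sets_gauss [simp, measurable_cong]: "sets (gauss v) = sets borel"
  by (simp add: gauss_def)

lemma space_gauss [simp]: "space (gauss v) = UNIV"
  by (simp add: gauss_def)

lemma prob_space_gauss: "0 < v \<Longrightarrow> prob_space (gauss v)"
  unfolding gauss_def by (rule prob_space_normal_density) simp

text \<open>Completing the square: the centred density times \<open>exp (c * x)\<close> is
  \<open>exp (c^2 * v / 2)\<close> times the normal density with mean \<open>c * v\<close> and the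
  same variance, which integrates to one.\<close>

lemma exp_gauss:
  assumes "0 < v"
  shows "has_bochner_integral (gauss v) (\<lambda>x. exp (c * x)) (exp (c\<^sup>2 * v / 2))"
proof -
  have eq: "normal_density 0 (sqrt v) x *\<^sub>R exp (c * x)
      = exp (c\<^sup>2 * v / 2) * normal_density (c * v) (sqrt v) x" for x
    using assms unfolding normal_density_def
    by (simp add: exp_add[symmetric] mult.left_commute power2_eq_square field_simps)
  have "has_bochner_integral lborel (\<lambda>x. normal_density 0 (sqrt v) x *\<^sub>R exp (c * x))
      (exp (c\<^sup>2 * v / 2) * 1)"
    unfolding eq using assms
    by (intro has_bochner_integral_mult_right)
      (auto simp: has_bochner_integral_iff)
  then show ?thesis
    unfolding gauss_def by (intro has_bochner_integral_density) auto
qed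

lemma convolution_gauss:
  assumes "0 < v" "0 < w"
  shows "gauss v \<star> gauss w = gauss (v + w)"
proof -
  have "gauss v \<star> gauss w = density lborel
      (\<lambda>x. \<integral>\<^sup>+y. ennreal (normal_density 0 (sqrt v) (x - y))
                 * ennreal (normal_density 0 (sqrt w) y) \<partial>lborel)"
    using prob_space_gauss[OF assms(1)] prob_space_gauss[OF assms(2)]
    unfolding gauss_def
    by (intro convolution_density) (auto simp: prob_space_def)
  also have "\<dots> = gauss (v + w)"
    using conv_normal_density_zero_mean[of "sqrt v" "sqrt w"] assms
    by (simp add: gauss_def ennreal_mult)
  finally show ?thesis .
qed

text \<open>A product measure is determined by its values on boxes. The indicator of a box splits
  into coordinate factors, so Tonelli reduces the claim to one coordinate, where it is the
  definition of convolution. With Gaussian factors this realises a vector of larger variance as the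
  sum of two independent Gaussian vectors.\<close>

lemma PiM_convolution:
  fixes M N :: "real measure"
  assumes "prob_space M" "prob_space N" "finite I"
    and sets_M [measurable_cong]: "sets M = sets borel"
    and sets_N [measurable_cong]: "sets N = sets borel"
  shows "PiM I (\<lambda>_. M \<star> N) = distr (PiM I (\<lambda>_. M) \<Otimes>\<^sub>M PiM I (\<lambda>_. N)) (PiM I (\<lambda>_. borel))
    (\<lambda>(x, y). \<lambda>i\<in>I. x i + y i)"
proof (rule sym)
  interpret M: prob_space M by fact
  interpret N: prob_space N by fact
  interpret PM: product_prob_space "\<lambda>_. M" I ..
  interpret PN: product_prob_space "\<lambda>_. N" I ..
  have sf: "sigma_finite_measure (PiM I (\<lambda>_. N))"
    by (intro prob_space_imp_sigma_finite prob_space_PiM assms)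
  interpret PMN: pair_prob_space "PiM I (\<lambda>_. M)" "PiM I (\<lambda>_. N)" ..
  interpret C: prob_space "M \<star> N"
    unfolding convolution_def by (intro prob_space.prob_space_distr prob_space_pair) (auto simp: assms)
  interpret PC: product_prob_space "\<lambda>_. M \<star> N" I ..
  have meas: "(\<lambda>(x, y). \<lambda>i\<in>I. x i + y i) \<in>
      PiM I (\<lambda>_. M) \<Otimes>\<^sub>M PiM I (\<lambda>_. N) \<rightarrow>\<^sub>M PiM I (\<lambda>_. borel)"
    unfolding case_prod_beta by measurable
  show "distr (PiM I (\<lambda>_. M) \<Otimes>\<^sub>M PiM I (\<lambda>_. N)) (PiM I (\<lambda>_. borel))
    (\<lambda>(x, y). \<lambda>i\<in>I. x i + y i) = PiM I (\<lambda>_. M \<star> N)" (is "?D = _")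
  proof (rule PC.PiM_eqI)
    show "sets ?D = sets (PiM I (\<lambda>_. M \<star> N))"
      by (auto intro!: sets_PiM_cong)
  next
    fix A assume "\<And>i. i \<in> I \<Longrightarrow> A i \<in> sets (M \<star> N)"
    then have A: "A i \<in> sets borel" if "i \<in> I" for i using that by simp
    have Am [measurable]: "Pi\<^sub>E I A \<in> sets (PiM I (\<lambda>_. borel))"
      by (intro sets_PiM_I_finite) (auto simp: A \<open>finite I\<close>)
    \<comment> \<open>Restriction to \<open>I\<close> makes the sum extensional, so membership in
      the box is a condition on each coordinate separately. The factorisation is then used twice:
      for the integral over \<open>y\<close> with \<open>x\<close> fixed, and for the remaining
      integral over \<open>x\<close>.\<close>
    have ind: "(indicator (Pi\<^sub>E I A) (\<lambda>i\<in>I. x i + y i) :: ennreal)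
        = (\<Prod>i\<in>I. indicator (A i) (x i + y i))" for x y
      using \<open>finite I\<close> by (auto simp: indicator_def PiE_iff intro!: prod_zero)
    have m2 [measurable]: "(\<lambda>p. indicator (A i) (fst p + snd p) :: ennreal) \<in> borel_measurable (M \<Otimes>\<^sub>M N)"
      if "i \<in> I" for i
      using A[OF that] by measurable
    have "emeasure ?D (Pi\<^sub>E I A) = (\<integral>\<^sup>+z. indicator (Pi\<^sub>E I A) z \<partial>?D)"
      by simp
    also have "\<dots> = (\<integral>\<^sup>+p. indicator (Pi\<^sub>E I A) (\<lambda>i\<in>I. fst p i + snd p i)
        \<partial>(PiM I (\<lambda>_. M) \<Otimes>\<^sub>M PiM I (\<lambda>_. N)))"
      by (subst nn_integral_distr[OF meas]) (auto simp: case_prod_beta)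
    also have "\<dots> = (\<integral>\<^sup>+x. \<integral>\<^sup>+y. indicator (Pi\<^sub>E I A) (\<lambda>i\<in>I. x i + y i) \<partial>PiM I (\<lambda>_. N) \<partial>PiM I (\<lambda>_. M))"
      by (subst sigma_finite_measure.nn_integral_fst[OF sf, symmetric]) (auto simp: case_prod_beta)
    also have "\<dots> = (\<integral>\<^sup>+x. (\<Prod>i\<in>I. \<integral>\<^sup>+t. indicator (A i) (x i + t) \<partial>N) \<partial>PiM I (\<lambda>_. M))"
    proof (intro nn_integral_cong)
      fix x
      have "(\<lambda>t. indicator (A i) (x i + t) :: ennreal) \<in> borel_measurable N" if "i \<in> I" for i
        using A[OF that] by measurable
      then show "(\<integral>\<^sup>+y. indicator (Pi\<^sub>E I A) (\<lambda>i\<in>I. x i + y i) \<partial>PiM I (\<lambda>_. N))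
          = (\<Prod>i\<in>I. \<integral>\<^sup>+t. indicator (A i) (x i + t) \<partial>N)"
        unfolding ind using \<open>finite I\<close> by (intro PN.product_nn_integral_prod)
    qed
    also have "\<dots> = (\<Prod>i\<in>I. \<integral>\<^sup>+s. \<integral>\<^sup>+t. indicator (A i) (s + t) \<partial>N \<partial>M)"
    proof (rule PM.product_nn_integral_prod[OF \<open>finite I\<close>])
      fix i assume "i \<in> I"
      show "(\<lambda>s. \<integral>\<^sup>+t. indicator (A i) (s + t) \<partial>N) \<in> borel_measurable M"
        using N.borel_measurable_nn_integral_fst[OF m2[OF \<open>i \<in> I\<close>]] by simp
    qed
    also have "\<dots> = (\<Prod>i\<in>I. emeasure (M \<star> N) (A i))"
      using A by (intro prod.cong refl convolution_emeasure'[symmetric])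
        (auto simp: sets_M sets_N M.finite_measure_axioms N.finite_measure_axioms)
    finally show "emeasure ?D (Pi\<^sub>E I A) = (\<Prod>i\<in>I. emeasure (M \<star> N) (A i))" .
  qed (fact \<open>finite I\<close>)
qed

section \<open>Growth and measurability of the payoff\<close>

lemma linear_growth_nonneg_bound:
  assumes "linear_growth \<phi>"
  obtains C where "0 \<le> C" "\<And>x. \<bar>\<phi> x\<bar> \<le> C * (1 + \<bar>x\<bar>)"
proof -
  obtain C where C: "\<And>x. \<bar>\<phi> x\<bar> \<le> C * (1 + \<bar>x\<bar>)"
    using assms unfolding linear_growth_def by auto
  have "0 \<le> C" using C[of 0] by (simp add: abs_le_iff)
  then show thesis using C that by blast
qed

lemma convex_UNIV_borel_measurable:
  fixes \<phi> :: "real \<Rightarrow> real"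
  assumes "convex_on UNIV \<phi>"
  shows "\<phi> \<in> borel_measurable borel"
  using convex_on_continuous[OF open_UNIV assms] by (rule borel_measurable_continuous_onI)

section \<open>Discrete baskets and their monotonicity in the variance\<close>

definition gauss_vec :: "nat \<Rightarrow> real \<Rightarrow> (nat \<Rightarrow> real) measure" where
  "gauss_vec n v = PiM {..<n} (\<lambda>_. gauss v)"

text \<open>The weight multiplying the \<open>k\<close>-th coefficient is a mean-one martingale when \<open>z\<close> is a vector of
  independent \<open>gauss v\<close> variables: \<open>z i\<close> plays the role of the increment of \<open>\<sigma> W\<close> over a time step
  \<open>h\<close>, with \<open>v = \<sigma>\<^sup>2 h\<close>.\<close>

definition basket :: "(nat \<Rightarrow> real) \<Rightarrow> nat \<Rightarrow> real \<Rightarrow> (nat \<Rightarrow> real) \<Rightarrow> real" where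
  "basket a n v z = (\<Sum>k<n. a k * (\<Prod>i\<le>k. exp (z i - v / 2)))"

text \<open>By independence the integral of the product is the product of the integrals, and the
  compensator \<open>exp (- v / 2)\<close> cancels the exponential moment \<open>exp (v / 2)\<close>
  of each coordinate.\<close>

lemma exp_martingale_gauss:
  assumes "0 < v" "k < n"
  shows "has_bochner_integral (gauss_vec n v) (\<lambda>z. \<Prod>i\<le>k. exp (z i - v / 2)) 1"
proof -
  interpret prob_space "gauss v" using assms(1) by (rule prob_space_gauss)
  interpret P: product_prob_space "\<lambda>_. gauss v" "{..<n}" ..
  \<comment> \<open>Padding with the constant 1 beyond \<open>k\<close> turns the product over
    \<open>i \<le> k\<close> into one over the whole index set, the form in which integrals of
    products factorise.\<close>
  define g :: "nat \<Rightarrow> real \<Rightarrow> real" where "g i x = (if i \<le> k then exp (x - v / 2) else 1)" for i x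
  have "has_bochner_integral (gauss v) (g i) 1" for i
  proof (cases "i \<le> k")
    case True
    have "has_bochner_integral (gauss v) (\<lambda>x. exp (- v / 2) * exp (1 * x)) (exp (- v / 2) * exp (1\<^sup>2 * v / 2))"
      using exp_gauss[OF assms(1), of 1] by (rule has_bochner_integral_mult_right)
    moreover have "g i = (\<lambda>x. exp (- v / 2) * exp (1 * x))"
      using True by (simp add: g_def fun_eq_iff exp_add[symmetric])
    ultimately show ?thesis by (simp add: exp_add[symmetric])
  next
    case False
    then show ?thesis
      using prob_space by (simp add: g_def[abs_def] has_bochner_integral_iff)
  qed
  then have g: "integrable (gauss v) (g i)" "integral\<^sup>L (gauss v) (g i) = 1" for i
    by (auto simp: has_bochner_integral_iff)
  have eq: "(\<Prod>i\<le>k. exp (z i - v / 2)) = (\<Prod>i<n. g i (z i))" for z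
    unfolding g_def using assms(2)
    by (auto simp: prod.If_cases intro!: prod.cong arg_cong[where f="prod _"])
  show ?thesis
    unfolding eq gauss_vec_def has_bochner_integral_iff
    using P.product_integrable_prod[of "{..<n}" g] P.product_integral_prod[of "{..<n}" g] g by simp
qed

lemma basket_measurable:
  assumes "n \<le> m"
  shows "basket a n v \<in> borel_measurable (gauss_vec m w)"
  unfolding basket_def[abs_def] gauss_vec_def
  using assms by (intro borel_measurable_sum borel_measurable_times borel_measurable_prod
      borel_measurable_const borel_measurable_exp borel_measurable_diff)
    (auto intro!: measurable_compose[OF measurable_component_singleton])

text \<open>Both the exponents and the compensators are additive, so each weight factorises. The
  restriction to \<open>{..<n}\<close> is harmless because only indices \<open>i \<le> k < n\<close>
  are read.\<close>

lemma basket_add: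
  "basket a n (v + w) (\<lambda>i\<in>{..<n}. x i + y i)
    = (\<Sum>k<n. a k * (\<Prod>i\<le>k. exp (x i - v / 2)) * (\<Prod>i\<le>k. exp (y i - w / 2)))"
proof -
  have "(\<Prod>i\<le>k. exp ((\<lambda>i\<in>{..<n}. x i + y i) i - (v + w) / 2))
      = (\<Prod>i\<le>k. exp (x i - v / 2)) * (\<Prod>i\<le>k. exp (y i - w / 2))" if "k < n" for k
    using that unfolding prod.distrib[symmetric]
    by (intro prod.cong refl) (auto simp: exp_add[symmetric] field_simps)
  then show ?thesis
    unfolding basket_def by (intro sum.cong refl) (simp add: mult.assoc)
qed

lemma (in pair_sigma_finite) integrable_mult_fst_snd:
  fixes f :: "'a \<Rightarrow> real" and g :: "'b \<Rightarrow> real"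
  assumes f: "integrable M1 f" and g: "integrable M2 g"
  shows "integrable (M1 \<Otimes>\<^sub>M M2) (\<lambda>p. f (fst p) * g (snd p))"
proof (rule Fubini_integrable)
  have [measurable]: "f \<in> borel_measurable M1" "g \<in> borel_measurable M2"
    using f g by auto
  show "(\<lambda>p. f (fst p) * g (snd p)) \<in> borel_measurable (M1 \<Otimes>\<^sub>M M2)"
    by measurable
qed (use f g in \<open>auto simp: abs_mult\<close>)

text \<open>Write the vector of variance \<open>v'\<close> as \<open>x + y\<close> with
  \<open>x\<close>, \<open>y\<close> independent of variances \<open>v\<close> and
  \<open>v' - v\<close>. Averaging over \<open>y\<close> with \<open>x\<close> fixed turns the
  larger basket into the smaller one, since the extra weights have mean one. Jensen in
  \<open>y\<close>, followed by integration over \<open>x\<close>, gives the inequality.\<close>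

lemma basket_premium_mono:
  assumes convex: "convex_on UNIV \<phi>" and growth: "linear_growth \<phi>"
    and v: "0 < v" "v \<le> v'"
  shows "(\<integral>z. \<phi> (basket a n v z) \<partial>gauss_vec n v) \<le> (\<integral>z. \<phi> (basket a n v' z) \<partial>gauss_vec n v')"
proof (cases "v = v'")
  \<comment> \<open>Equal variances are treated apart because \<open>gauss 0\<close> is the null
    measure and not the Dirac mass at 0: the decomposition needs a strictly positive extra
    variance.\<close>
  case False
  define w where "w = v' - v"
  have w: "0 < w" "v' = v + w" using v False by (auto simp: w_def)
  define P where "P = gauss_vec n v"
  define Q where "Q = gauss_vec n w"
  interpret P: prob_space P
    unfolding P_def gauss_vec_def by (intro prob_space_PiM prob_space_gauss v)
  interpret Q: prob_space Q
    unfolding Q_def gauss_vec_def by (intro prob_space_PiM prob_space_gauss w)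
  interpret PQ: pair_prob_space P Q ..
  note [measurable] = convex_UNIV_borel_measurable[OF convex]
  define E where "E u k z = (\<Prod>i\<le>k. exp (z i - u / 2))" for u :: real and k :: nat and z :: "nat \<Rightarrow> real"
  have EP: "integrable P (E v k)" and EQ: "integrable Q (E w k)" "integral\<^sup>L Q (E w k) = 1" if "k < n" for k
    using exp_martingale_gauss[OF v(1) that] exp_martingale_gauss[OF w(1) that]
    by (auto simp: P_def Q_def E_def[abs_def] has_bochner_integral_iff)
  \<comment> \<open>By \<open>basket_add\<close>, this is the basket with variance parameter
    \<open>v'\<close> evaluated at the sum of the two vectors.\<close>
  define F where "F p = (\<Sum>k<n. a k * (E v k (fst p) * E w k (snd p)))" for p
  have intF: "integrable (P \<Otimes>\<^sub>M Q) F"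
    unfolding F_def
    by (intro Bochner_Integration.integrable_sum Bochner_Integration.integrable_mult_right
        PQ.integrable_mult_fst_snd EP EQ) auto
  then have [measurable]: "F \<in> borel_measurable (P \<Otimes>\<^sub>M Q)" by auto
  obtain C where C: "0 \<le> C" "\<And>x. \<bar>\<phi> x\<bar> \<le> C * (1 + \<bar>x\<bar>)"
    using linear_growth_nonneg_bound[OF growth] by blast
  have int\<phi>F: "integrable (P \<Otimes>\<^sub>M Q) (\<lambda>p. \<phi> (F p))"
  proof (rule Bochner_Integration.integrable_bound)
    show "integrable (P \<Otimes>\<^sub>M Q) (\<lambda>p. C * (1 + \<bar>F p\<bar>))"
      using intF by simp
  qed (use C in \<open>auto simp: abs_mult\<close>)
  have mean: "(\<integral>y. F (x, y) \<partial>Q) = basket a n v x" for x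
  proof -
    have "(\<integral>y. F (x, y) \<partial>Q) = (\<Sum>k<n. \<integral>y. a k * (E v k x * E w k y) \<partial>Q)"
      unfolding F_def fst_conv snd_conv
      by (intro Bochner_Integration.integral_sum Bochner_Integration.integrable_mult_right EQ) auto
    also have "\<dots> = (\<Sum>k<n. a k * E v k x)"
      using EQ by (intro sum.cong) auto
    finally show ?thesis by (simp add: basket_def E_def)
  qed
  have [measurable]: "basket a n v \<in> borel_measurable P"
    unfolding P_def by (rule basket_measurable) simp
  have "basket a n v' \<in> borel_measurable (gauss_vec n v')"
    by (rule basket_measurable) simp
  then have [measurable]: "basket a n v' \<in> borel_measurable (PiM {..<n} (\<lambda>_. borel))"
    by (simp add: gauss_vec_def cong: sets_PiM_cong measurable_cong_sets)
  have law: "gauss_vec n v' = distr (P \<Otimes>\<^sub>M Q) (PiM {..<n} (\<lambda>_. borel)) (\<lambda>(x, y). \<lambda>i\<in>{..<n}. x i + y i)"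
    unfolding gauss_vec_def P_def Q_def w(2)
    using PiM_convolution[OF prob_space_gauss[OF v(1)] prob_space_gauss[OF w(1)], of "{..<n}"]
    by (simp add: convolution_gauss v w)
  have add: "(\<lambda>(x, y). \<lambda>i\<in>{..<n}. x i + y i) \<in> P \<Otimes>\<^sub>M Q \<rightarrow>\<^sub>M PiM {..<n} (\<lambda>_. borel)"
    unfolding case_prod_beta P_def Q_def gauss_vec_def by measurable
  have "(\<integral>z. \<phi> (basket a n v z) \<partial>gauss_vec n v) = (\<integral>x. \<phi> (\<integral>y. F (x, y) \<partial>Q) \<partial>P)"
    by (simp add: mean P_def)
  also have "\<dots> \<le> (\<integral>x. \<integral>y. \<phi> (F (x, y)) \<partial>Q \<partial>P)"
  proof (rule integral_mono_AE)
    \<comment> \<open>Jensen needs \<open>F\<close> and \<open>\<phi> \<circ> F\<close> to be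
      integrable in \<open>y\<close>; Fubini provides this for almost every
      \<open>x\<close>.\<close>
    show "AE x in P. \<phi> (\<integral>y. F (x, y) \<partial>Q) \<le> (\<integral>y. \<phi> (F (x, y)) \<partial>Q)"
      using PQ.AE_integrable_fst'[OF int\<phi>F] PQ.AE_integrable_fst'[OF intF]
      by eventually_elim (intro Q.jensens_inequality[where I=UNIV] convex, auto)
    show "integrable P (\<lambda>x. \<integral>y. \<phi> (F (x, y)) \<partial>Q)"
      by (rule PQ.integrable_fst'[OF int\<phi>F])
    have "integrable P (basket a n v)"
      using PQ.integrable_fst'[OF intF] by (simp add: mean)
    then have "integrable P (\<lambda>x. C * (1 + \<bar>basket a n v x\<bar>))" by simp
    then have "integrable P (\<lambda>x. \<phi> (basket a n v x))"
      by (rule Bochner_Integration.integrable_bound) (use C in \<open>auto simp: abs_mult\<close>)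
    then show "integrable P (\<lambda>x. \<phi> (\<integral>y. F (x, y) \<partial>Q))" by (simp add: mean)
  qed
  also have "\<dots> = (\<integral>p. \<phi> (F p) \<partial>(P \<Otimes>\<^sub>M Q))"
    by (rule PQ.integral_fst'[OF int\<phi>F])
  also have "\<dots> = (\<integral>p. \<phi> (basket a n v' (\<lambda>i\<in>{..<n}. fst p i + snd p i)) \<partial>(P \<Otimes>\<^sub>M Q))"
    by (simp add: w(2) basket_add F_def E_def mult.assoc)
  also have "\<dots> = (\<integral>z. \<phi> (basket a n v' z) \<partial>gauss_vec n v')"
    unfolding law by (subst integral_distr[OF add]) (auto simp: case_prod_beta)
  finally show ?thesis .
qed simp

section \<open>Limit theorems\<close>

text \<open>Bounded second moments give uniform integrability. Dominated convergence handles the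
  functions truncated at a level \<open>N\<close>, and the truncation error is controlled by
  \<open>h - min h N \<le> h^2 / N\<close>.\<close>

lemma tendsto_integral_L2_bounded:
  fixes f :: "nat \<Rightarrow> 'a \<Rightarrow> real"
  assumes "prob_space M"
    and f: "\<And>n. f n \<in> borel_measurable M" "\<And>n x. 0 \<le> f n x"
    and lim: "\<And>x. x \<in> space M \<Longrightarrow> (\<lambda>n. f n x) \<longlonglongrightarrow> g x"
    and int: "\<And>n. integrable M (\<lambda>x. (f n x)\<^sup>2)" and bound: "\<And>n. (\<integral>x. (f n x)\<^sup>2 \<partial>M) \<le> K"
  shows "(\<lambda>n. \<integral>x. f n x \<partial>M) \<longlonglongrightarrow> (\<integral>x. g x \<partial>M)"
proof -
  interpret prob_space M by fact
  note [measurable] = f(1)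
  have g_meas [measurable]: "g \<in> borel_measurable M"
    by (rule borel_measurable_LIMSEQ_real[OF lim f(1)])
  have g_nonneg: "0 \<le> g x" if "x \<in> space M" for x
    by (rule LIMSEQ_le_const[OF lim[OF that]]) (use f(2) in auto)
  have "(\<integral>\<^sup>+x. ennreal ((g x)\<^sup>2) \<partial>M) = (\<integral>\<^sup>+x. liminf (\<lambda>n. ennreal ((f n x)\<^sup>2)) \<partial>M)"
  proof (rule nn_integral_cong)
    fix x assume x: "x \<in> space M"
    have "(\<lambda>n. ennreal ((f n x)\<^sup>2)) \<longlonglongrightarrow> ennreal ((g x)\<^sup>2)"
      by (intro tendsto_ennrealI tendsto_power lim x)
    then show "ennreal ((g x)\<^sup>2) = liminf (\<lambda>n. ennreal ((f n x)\<^sup>2))"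
      by (intro lim_imp_Liminf[symmetric]) auto
  qed
  also have "\<dots> \<le> liminf (\<lambda>n. \<integral>\<^sup>+x. ennreal ((f n x)\<^sup>2) \<partial>M)"
    by (rule nn_integral_liminf) simp
  also have "\<dots> \<le> ennreal K"
  proof (rule Liminf_le)
    show "\<forall>\<^sub>F n in sequentially. (\<integral>\<^sup>+x. ennreal ((f n x)\<^sup>2) \<partial>M) \<le> ennreal K"
      using int bound by (auto simp: nn_integral_eq_integral intro!: ennreal_leI always_eventually)
  qed simp
  finally have fatou: "(\<integral>\<^sup>+x. ennreal ((g x)\<^sup>2) \<partial>M) \<le> ennreal K" .
  \<comment> \<open>Fatou passes the second moment bound on to the limit, so that the truncation
    estimate applies to \<open>g\<close> as well.\<close>
  then have int_g2: "integrable M (\<lambda>x. (g x)\<^sup>2)"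
    by (intro integrableI_bounded) (auto simp: le_less_trans)
  have K: "0 \<le> K"
    using bound[of 0] by (rule order_trans[rotated]) simp
  have bound_g: "(\<integral>x. (g x)\<^sup>2 \<partial>M) \<le> K"
    using fatou int_g2 K by (simp add: nn_integral_eq_integral)
  \<comment> \<open>Truncation at level \<open>N\<close> costs at most \<open>K / N\<close>, uniformly along the sequence.\<close>
  have trunc: "\<bar>(\<integral>x. h x \<partial>M) - (\<integral>x. min (h x) N \<partial>M)\<bar> \<le> K / N"
    if h: "h \<in> borel_measurable M" "\<And>x. x \<in> space M \<Longrightarrow> 0 \<le> h x" "integrable M (\<lambda>x. (h x)\<^sup>2)"
      "(\<integral>x. (h x)\<^sup>2 \<partial>M) \<le> K" and N: "0 < N" for h :: "'a \<Rightarrow> real" and N :: real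
  proof -
    note [measurable] = h(1)
    have ih: "integrable M h"
      by (rule square_integrable_imp_integrable[OF h(1,3)])
    have im: "integrable M (\<lambda>x. min (h x) N)"
      using ih by (intro integrable_min) auto
    have pt: "\<bar>h x - min (h x) N\<bar> \<le> (h x)\<^sup>2 / N" if "x \<in> space M" for x
    proof (cases "h x \<le> N")
      case False
      then have "h x * N \<le> h x * h x" using N by (intro mult_left_mono) auto
      then have "h x \<le> (h x)\<^sup>2 / N" using N by (simp add: field_simps power2_eq_square)
      then show ?thesis using False N by simp
    qed (use N in simp)
    have "\<bar>(\<integral>x. h x \<partial>M) - (\<integral>x. min (h x) N \<partial>M)\<bar> = \<bar>\<integral>x. h x - min (h x) N \<partial>M\<bar>"
      using ih im by simp
    also have "\<dots> \<le> (\<integral>x. \<bar>h x - min (h x) N\<bar> \<partial>M)"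
      by (rule integral_abs_bound)
    also have "\<dots> \<le> (\<integral>x. (h x)\<^sup>2 / N \<partial>M)"
      using ih im h(3) pt by (intro integral_mono) auto
    also have "\<dots> \<le> K / N"
      using h(4) N by (simp add: divide_right_mono)
    finally show ?thesis .
  qed
  show ?thesis
  proof (rule LIMSEQ_I)
    fix e :: real assume e: "0 < e"
    \<comment> \<open>Two truncation errors and one dominated convergence error, each below
      \<open>e / 4\<close>, add up to less than \<open>e\<close>. The summand 1 keeps
      \<open>N\<close> positive when \<open>K = 0\<close>.\<close>
    define N where "N = 4 * (K + 1) / e"
    have N: "0 < N" "K / N < e / 4"
      using e K by (auto simp: N_def field_simps)
    have "(\<lambda>n. \<integral>x. min (f n x) N \<partial>M) \<longlonglongrightarrow> (\<integral>x. min (g x) N \<partial>M)"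
    proof (rule integral_dominated_convergence[where w="\<lambda>_. N"])
      show "AE x in M. (\<lambda>n. min (f n x) N) \<longlonglongrightarrow> min (g x) N"
        using lim by (intro AE_I2 tendsto_min) auto
    qed (use f(2) N in auto)
    then have "\<exists>n0. \<forall>n\<ge>n0. norm ((\<integral>x. min (f n x) N \<partial>M) - (\<integral>x. min (g x) N \<partial>M)) < e / 4"
      by (rule LIMSEQ_D) (use e in simp)
    then obtain n0 where n0: "\<And>n. n0 \<le> n \<Longrightarrow> \<bar>(\<integral>x. min (f n x) N \<partial>M) - (\<integral>x. min (g x) N \<partial>M)\<bar> < e / 4"
      unfolding real_norm_def by blast
    have "norm ((\<integral>x. f n x \<partial>M) - (\<integral>x. g x \<partial>M)) < e" if "n0 \<le> n" for n
      using n0[OF that] trunc[OF f(1) f(2) int bound N(1), of n]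
        trunc[OF g_meas g_nonneg int_g2 bound_g N(1)] N(2) unfolding real_norm_def by linarith
    then show "\<exists>n0. \<forall>n\<ge>n0. norm ((\<integral>x. f n x \<partial>M) - (\<integral>x. g x \<partial>M)) < e" by blast
  qed
qed

text \<open>Uniform continuity on the compact interval: once the mesh is below the modulus
  \<open>d\<close>, the integrand differs from its right endpoint value by at most
  \<open>e / (2 * T)\<close> on each cell, hence the total error is at most \<open>e / 2\<close>.
  Using \<open>Suc n\<close> cells avoids division by zero.\<close>

lemma right_riemann_sum_tendsto:
  fixes f :: "real \<Rightarrow> real"
  assumes "0 < T" and cont: "continuous_on {0..T} f"
  shows "(\<lambda>n. \<Sum>k<Suc n. T / Suc n * f (Suc k * (T / Suc n))) \<longlonglongrightarrow> integral {0..T} f"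
proof (rule LIMSEQ_I)
  fix e :: real assume e: "0 < e"
  have "uniformly_continuous_on {0..T} f"
    using cont by (rule compact_uniformly_continuous) simp
  then obtain d where d: "0 < d"
    "\<And>x y. x \<in> {0..T} \<Longrightarrow> y \<in> {0..T} \<Longrightarrow> dist y x < d \<Longrightarrow> dist (f y) (f x) < e / (2 * T)"
    using e \<open>0 < T\<close> unfolding uniformly_continuous_on_def
    by (metis divide_pos_pos mult_pos_pos zero_less_numeral)
  obtain n0 :: nat where n0: "T / d < n0" using reals_Archimedean2 by blast
  have "norm ((\<Sum>k<Suc n. T / Suc n * f (Suc k * (T / Suc n))) - integral {0..T} f) < e" if "n0 \<le> n" for n
  proof -
    define h where "h = T / Suc n"
    have h: "0 < h" "h * Suc n = T" using \<open>0 < T\<close> by (auto simp: h_def field_simps)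
    have hd: "h < d"
    proof -
      have "T / d < Suc n" using n0 that by linarith
      then show ?thesis using d(1) by (simp add: h_def field_simps)
    qed
    \<comment> \<open>Induction on the number of cells, with an error allowance proportional to the
      elapsed time \<open>m * h\<close>.\<close>
    have mesh: "\<bar>(\<Sum>k<m. h * f (Suc k * h)) - integral {0..m * h} f\<bar> \<le> m * h * (e / (2 * T))"
      if "m \<le> Suc n" for m
      using that
    proof (induction m)
      case (Suc m)
      have le: "Suc m * h \<le> T"
        using Suc.prems h by (metis mult.commute mult_right_mono of_nat_le_iff less_imp_le)
      have mh: "0 \<le> m * h" "m * h \<le> Suc m * h" "Suc m * h - m * h = h"
        using h(1) by (auto simp: algebra_simps)
      have int: "f integrable_on {x..y}" if "0 \<le> x" "y \<le> T" for x y
        using that by (intro integrable_continuous_interval continuous_on_subset[OF cont]) auto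
      have split: "integral {0..Suc m * h} f = integral {0..m * h} f + integral {m * h..Suc m * h} f"
        using le mh by (intro Henstock_Kurzweil_Integration.integral_combine[symmetric] int) auto
      have "integral {m * h..Suc m * h} (\<lambda>x. f (Suc m * h) - f x)
          = h * f (Suc m * h) - integral {m * h..Suc m * h} f"
        using le mh by (subst Henstock_Kurzweil_Integration.integral_diff) (auto intro!: int simp: mult.commute)
      moreover have "norm (integral {m * h..Suc m * h} (\<lambda>x. f (Suc m * h) - f x)) \<le> e / (2 * T) * (Suc m * h - m * h)"
      proof (rule integral_bound)
        show "continuous_on {m * h..Suc m * h} (\<lambda>x. f (Suc m * h) - f x)"
          using le mh by (intro continuous_intros continuous_on_subset[OF cont]) auto
        fix x assume x: "x \<in> {m * h..Suc m * h}"
        then have "m * h \<le> x" "x \<le> Suc m * h" by simp_all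
        then have "0 \<le> x" "x \<le> T" "0 \<le> Suc m * h" "\<bar>Suc m * h - x\<bar> < d"
          using le mh hd by linarith+
        then have "dist (f (Suc m * h)) (f x) < e / (2 * T)"
          using le by (intro d(2)) (simp_all add: dist_real_def)
        then show "norm (f (Suc m * h) - f x) \<le> e / (2 * T)" by (simp add: dist_real_def)
      qed (use mh in auto)
      ultimately have step: "\<bar>h * f (Suc m * h) - integral {m * h..Suc m * h} f\<bar> \<le> h * (e / (2 * T))"
        using mh(3) by (simp add: mult.commute)
      have "\<bar>(\<Sum>k<m. h * f (Suc k * h)) - integral {0..m * h} f\<bar> \<le> m * h * (e / (2 * T))"
        using Suc by simp
      moreover have "Suc m * h * (e / (2 * T)) = m * h * (e / (2 * T)) + h * (e / (2 * T))"
        by (simp add: ring_distribs add_divide_distrib)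
      ultimately show ?case
        using step split unfolding sum.lessThan_Suc by linarith
    qed simp
    have "\<bar>(\<Sum>k<Suc n. h * f (Suc k * h)) - integral {0..Suc n * h} f\<bar> \<le> Suc n * h * (e / (2 * T))"
      by (rule mesh) simp
    also have "\<dots> = e / 2"
      using h(2) \<open>0 < T\<close> by (simp add: mult.commute)
    also have "\<dots> < e" using e by simp
    finally show ?thesis using h(2) by (simp add: h_def mult.commute)
  qed
  then show "\<exists>n0. \<forall>n\<ge>n0. norm ((\<Sum>k<Suc n. T / Suc n * f (Suc k * (T / Suc n))) - integral {0..T} f) < e"
    by blast
qed

section \<open>Discretely monitored Asian options\<close>

context standard_brownian_motion
begin

lemma distr_gaussian_increment:
  assumes "0 \<le> s" "s < t" "0 < \<sigma>"
  shows "distr M borel (\<lambda>\<omega>. \<sigma> * (W t \<omega> - W s \<omega>)) = gauss (\<sigma>\<^sup>2 * (t - s))"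
proof -
  have "distributed M lborel (\<lambda>\<omega>. 0 + \<sigma> * (W t \<omega> - W s \<omega>))
      (normal_density (0 + \<sigma> * 0) (\<bar>\<sigma>\<bar> * sqrt (t - s)))"
    using assms by (intro normal_density_affine gaussian_increments) auto
  from distributed_distr_eq_density[OF this]
  have "distr M lborel (\<lambda>\<omega>. \<sigma> * (W t \<omega> - W s \<omega>)) = gauss (\<sigma>\<^sup>2 * (t - s))"
    using assms by (simp add: gauss_def real_sqrt_mult)
  then show ?thesis by (simp cong: distr_cong)
qed

text \<open>Scaling by \<open>\<sigma>\<close> preserves independence of the increments, so their
  joint law is the product of the marginals, and on a uniform grid all marginals have variance
  \<open>\<sigma>^2 * h\<close>.\<close>

lemma distr_increments:
  fixes h :: real
  assumes "0 < h" "0 < \<sigma>" "0 < n"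
  shows "distr M (PiM {..<n} (\<lambda>_. borel)) (\<lambda>\<omega>. \<lambda>i\<in>{..<n}. \<sigma> * (W (Suc i * h) \<omega> - W (i * h) \<omega>))
    = gauss_vec n (\<sigma>\<^sup>2 * h)"
proof -
  have meas: "(\<lambda>\<omega>. \<sigma> * (W (Suc i * h) \<omega> - W (i * h) \<omega>)) \<in> borel_measurable M" for i :: nat
    using assms by (intro borel_measurable_times borel_measurable_diff measurable) auto
  have "indep_vars (\<lambda>_. borel) (\<lambda>i \<omega>. W (Suc i * h) \<omega> - W (i * h) \<omega>) {..<n}"
    using assms by (intro independent_increments[of "\<lambda>i. i * h" n]) auto
  then have "indep_vars (\<lambda>_. borel) (\<lambda>i \<omega>. \<sigma> * (W (Suc i * h) \<omega> - W (i * h) \<omega>)) {..<n}"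
    by (rule indep_vars_compose2) simp
  then have "distr M (PiM {..<n} (\<lambda>_. borel)) (\<lambda>\<omega>. \<lambda>i\<in>{..<n}. \<sigma> * (W (Suc i * h) \<omega> - W (i * h) \<omega>))
      = PiM {..<n} (\<lambda>i. distr M borel (\<lambda>\<omega>. \<sigma> * (W (Suc i * h) \<omega> - W (i * h) \<omega>)))"
    by (subst (asm) indep_vars_iff_distr_eq_PiM') (use assms(3) meas in \<open>auto simp del: of_nat_Suc\<close>)
  also have "\<dots> = gauss_vec n (\<sigma>\<^sup>2 * h)"
    unfolding gauss_vec_def
  proof (intro PiM_cong refl)
    fix i :: nat
    have "Suc i * h - i * h = h" by (simp add: algebra_simps)
    then show "distr M borel (\<lambda>\<omega>. \<sigma> * (W (Suc i * h) \<omega> - W (i * h) \<omega>)) = gauss (\<sigma>\<^sup>2 * h)"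
      using assms by (subst distr_gaussian_increment) auto
  qed
  finally show ?thesis .
qed

lemma black_scholes_measurable:
  assumes "0 \<le> t"
  shows "black_scholes W s0 \<sigma> r t \<in> borel_measurable M"
  using measurable[OF assms] unfolding black_scholes_def[abs_def] by simp

text \<open>The increments telescope to \<open>W (Suc k * h)\<close> because the path starts at 0.
  The interest rate goes into a deterministic coefficient, while the \<open>\<sigma>^2 / 2\<close>
  drift is shared out as the compensators of the weights.\<close>

lemma black_scholes_eq_prod_increments:
  fixes h :: real
  assumes "W 0 \<omega> = 0"
  shows "black_scholes W s0 \<sigma> r (Suc k * h) \<omega> = s0 * exp (r * (Suc k * h))
    * (\<Prod>i\<le>k. exp (\<sigma> * (W (Suc i * h) \<omega> - W (i * h) \<omega>) - \<sigma>\<^sup>2 * h / 2))"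
proof -
  have "(\<Sum>i\<le>k. \<sigma> * (W (Suc i * h) \<omega> - W (i * h) \<omega>) - \<sigma>\<^sup>2 * h / 2)
      = \<sigma> * W (Suc k * h) \<omega> - \<sigma>\<^sup>2 / 2 * (Suc k * h)"
    by (induction k) (simp_all add: assms algebra_simps add_divide_distrib)
  then show ?thesis
    by (simp add: black_scholes_def exp_sum[symmetric] mult.assoc exp_add[symmetric] algebra_simps
        del: of_nat_Suc)
qed

text \<open>The Brownian motion enters only through the law of its scaled increments, so the
  expectation becomes a Gaussian integral with \<open>\<sigma>\<close> present only in the variance
  \<open>\<sigma>^2 * h\<close>. For \<open>r = 0\<close> the coefficients do not depend on
  \<open>h\<close> either, which makes different maturities comparable.\<close>

lemma expectation_black_scholes_average:
  fixes h :: real and \<phi> :: "real \<Rightarrow> real"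
  assumes "\<phi> \<in> borel_measurable borel" "0 < h" "0 < \<sigma>" "0 < n"
  shows "expectation (\<lambda>\<omega>. \<phi> ((\<Sum>k<n. black_scholes W s0 \<sigma> r (Suc k * h) \<omega>) / n))
    = (\<integral>z. \<phi> (basket (\<lambda>k. s0 * exp (r * (Suc k * h)) / n) n (\<sigma>\<^sup>2 * h) z) \<partial>gauss_vec n (\<sigma>\<^sup>2 * h))"
proof -
  note [measurable] = assms(1)
  let ?a = "\<lambda>k. s0 * exp (r * (Suc k * h)) / n"
  let ?X = "\<lambda>\<omega>. \<lambda>i\<in>{..<n}. \<sigma> * (W (Suc i * h) \<omega> - W (i * h) \<omega>)"
  have "basket ?a n (\<sigma>\<^sup>2 * h) \<in> borel_measurable (gauss_vec n (\<sigma>\<^sup>2 * h))"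
    by (rule basket_measurable) simp
  then have [measurable]: "basket ?a n (\<sigma>\<^sup>2 * h) \<in> borel_measurable (PiM {..<n} (\<lambda>_. borel))"
    by (simp add: gauss_vec_def cong: sets_PiM_cong measurable_cong_sets)
  have X [measurable]: "?X \<in> M \<rightarrow>\<^sub>M PiM {..<n} (\<lambda>_. borel)"
    using assms by (intro measurable_restrict borel_measurable_times borel_measurable_diff measurable) auto
  have bs [measurable]: "(\<lambda>\<omega>. black_scholes W s0 \<sigma> r (Suc k * h) \<omega>) \<in> borel_measurable M" for k
    using assms by (intro black_scholes_measurable) auto
  have "AE \<omega> in M. (\<Sum>k<n. black_scholes W s0 \<sigma> r (Suc k * h) \<omega>) / n = basket ?a n (\<sigma>\<^sup>2 * h) (?X \<omega>)"
    using start
  proof eventually_elim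
    case (elim \<omega>)
    show ?case
      unfolding basket_def sum_divide_distrib
      by (intro sum.cong refl) (auto simp: black_scholes_eq_prod_increments[OF elim]
          simp del: of_nat_Suc intro!: prod.cong)
  qed
  then have "expectation (\<lambda>\<omega>. \<phi> ((\<Sum>k<n. black_scholes W s0 \<sigma> r (Suc k * h) \<omega>) / n))
      = expectation (\<lambda>\<omega>. \<phi> (basket ?a n (\<sigma>\<^sup>2 * h) (?X \<omega>)))"
    by (intro integral_cong_AE) (measurable, auto)
  also have "\<dots> = (\<integral>z. \<phi> (basket ?a n (\<sigma>\<^sup>2 * h) z) \<partial>gauss_vec n (\<sigma>\<^sup>2 * h))"
    unfolding distr_increments[OF assms(2-4), symmetric]
    by (subst integral_distr[OF X]) (simp_all del: of_nat_Suc)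
  finally show ?thesis .
qed

text \<open>The square of the price is a deterministic factor with rate
  \<open>2 * r - \<sigma>^2\<close> times the exponential of twice a Gaussian of variance
  \<open>\<sigma>^2 * t\<close>, whose mean has rate \<open>2 * \<sigma>^2\<close>.\<close>

lemma second_moment_black_scholes:
  assumes "0 < t" "0 < \<sigma>"
  shows "has_bochner_integral M (\<lambda>\<omega>. (black_scholes W s0 \<sigma> r t \<omega>)\<^sup>2) (s0\<^sup>2 * exp ((2 * r + \<sigma>\<^sup>2) * t))"
proof -
  have [measurable]: "(\<lambda>\<omega>. black_scholes W s0 \<sigma> r t \<omega>) \<in> borel_measurable M"
    using assms by (intro black_scholes_measurable) auto
  let ?X = "\<lambda>\<omega>. \<sigma> * (W t \<omega> - W 0 \<omega>)"
  have X [measurable]: "?X \<in> borel_measurable M"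
    using assms by (intro borel_measurable_times borel_measurable_diff measurable) auto
  have "has_bochner_integral (distr M borel ?X) (\<lambda>x. exp (2 * x)) (exp (2\<^sup>2 * (\<sigma>\<^sup>2 * t) / 2))"
    using distr_gaussian_increment[of 0 t \<sigma>] exp_gauss[of "\<sigma>\<^sup>2 * t" 2] assms by simp
  then have "has_bochner_integral M (\<lambda>\<omega>. exp (2 * ?X \<omega>)) (exp (2 * \<sigma>\<^sup>2 * t))"
    by (simp add: has_bochner_integral_iff integrable_distr_eq integral_distr)
  then have "has_bochner_integral M (\<lambda>\<omega>. s0\<^sup>2 * exp ((2 * r - \<sigma>\<^sup>2) * t) * exp (2 * ?X \<omega>))
      (s0\<^sup>2 * exp ((2 * r - \<sigma>\<^sup>2) * t) * exp (2 * \<sigma>\<^sup>2 * t))"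
    by (rule has_bochner_integral_mult_right)
  moreover have "AE \<omega> in M. s0\<^sup>2 * exp ((2 * r - \<sigma>\<^sup>2) * t) * exp (2 * ?X \<omega>) = (black_scholes W s0 \<sigma> r t \<omega>)\<^sup>2"
    using start
  proof eventually_elim
    case (elim \<omega>)
    then show ?case
      by (simp add: black_scholes_def power_mult_distrib exp_double[symmetric] mult.assoc
          exp_add[symmetric])
  qed
  ultimately have "has_bochner_integral M (\<lambda>\<omega>. (black_scholes W s0 \<sigma> r t \<omega>)\<^sup>2)
      (s0\<^sup>2 * exp ((2 * r - \<sigma>\<^sup>2) * t) * exp (2 * \<sigma>\<^sup>2 * t))"
    by (subst (asm) has_bochner_integral_cong_AE) auto
  moreover have "exp ((2 * r - \<sigma>\<^sup>2) * t) * exp (2 * \<sigma>\<^sup>2 * t) = exp ((2 * r + \<sigma>\<^sup>2) * t)"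
    by (simp add: exp_add[symmetric] algebra_simps)
  ultimately show ?thesis by (simp add: mult.assoc)
qed

text \<open>Pathwise: the price path is continuous on \<open>{0..T}\<close>, so its Lebesgue
  integral agrees with the gauge integral and is the limit of the right Riemann sums.\<close>

lemma black_scholes_average_tendsto:
  assumes "0 < T" "\<omega> \<in> space M"
  shows "(\<lambda>n. (\<Sum>k<Suc n. black_scholes W s0 \<sigma> r (Suc k * (T / Suc n)) \<omega>) / Suc n)
    \<longlonglongrightarrow> 1 / T * (LBINT s:{0..T}. black_scholes W s0 \<sigma> r s \<omega>)"
proof -
  let ?f = "\<lambda>s. black_scholes W s0 \<sigma> r s \<omega>"
  have cont: "continuous_on {0..T} ?f"
    unfolding black_scholes_def
    by (intro continuous_intros continuous_on_subset[OF continuous_paths[OF assms(2)]]) auto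
  have "(LBINT s:{0..T}. ?f s) = integral {0..T} ?f"
    by (intro set_borel_integral_eq_integral borel_integrable_atLeastAtMost' cont)
  moreover have "(\<lambda>n. 1 / T * (\<Sum>k<Suc n. T / Suc n * ?f (Suc k * (T / Suc n)))) \<longlonglongrightarrow> 1 / T * integral {0..T} ?f"
    by (intro tendsto_mult_left right_riemann_sum_tendsto assms cont)
  moreover have "1 / T * (\<Sum>k<Suc n. T / Suc n * ?f (Suc k * (T / Suc n)))
      = (\<Sum>k<Suc n. ?f (Suc k * (T / Suc n))) / Suc n" for n
    using assms(1) by (simp add: sum_distrib_left sum_divide_distrib del: sum.lessThan_Suc of_nat_Suc)
  ultimately show ?thesis by simp
qed

text \<open>The payoffs of the discrete averages converge pathwise by continuity of \<phi>. Linear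
  growth and the second moments of the price bound them in L2 uniformly in \<open>n\<close>, so
  their expectations converge too.\<close>

lemma premium_tendsto:
  assumes nonneg: "\<And>x. 0 \<le> \<phi> x" and convex: "convex_on UNIV \<phi>" and growth: "linear_growth \<phi>"
    and "0 < \<sigma>" "0 < T"
  shows "(\<lambda>n. exp (- r * T) *
      (\<integral>z. \<phi> (basket (\<lambda>k. s0 * exp (r * (Suc k * (T / Suc n))) / Suc n) (Suc n) (\<sigma>\<^sup>2 * (T / Suc n)) z)
        \<partial>gauss_vec (Suc n) (\<sigma>\<^sup>2 * (T / Suc n))))
    \<longlonglongrightarrow> premium M W \<phi> s0 \<sigma> r T"
proof -
  note \<phi>_meas [measurable] = convex_UNIV_borel_measurable[OF convex]
  obtain C where C: "0 \<le> C" "\<And>x. \<bar>\<phi> x\<bar> \<le> C * (1 + \<bar>x\<bar>)"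
    using linear_growth_nonneg_bound[OF growth] by blast
  define A where "A n \<omega> = (\<Sum>k<Suc n. black_scholes W s0 \<sigma> r (Suc k * (T / Suc n)) \<omega>) / Suc n" for n \<omega>
  have bs [measurable]: "black_scholes W s0 \<sigma> r (Suc k * (T / Suc n)) \<in> borel_measurable M" for k n
    using \<open>0 < T\<close> by (intro black_scholes_measurable) auto
  have A_meas [measurable]: "A n \<in> borel_measurable M" for n
    unfolding A_def by (intro borel_measurable_divide borel_measurable_sum bs borel_measurable_const)
  \<comment> \<open>A second moment bound valid at all times in \<open>(0, T]\<close>: with
    \<open>\<bar>r\<bar>\<close> the rate is nonnegative, so its value at \<open>T\<close> dominates
    earlier times even when \<open>r\<close> is negative.\<close>
  define B where "B = s0\<^sup>2 * exp ((2 * \<bar>r\<bar> + \<sigma>\<^sup>2) * T)"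
  have moment: "integrable M (\<lambda>\<omega>. (black_scholes W s0 \<sigma> r t \<omega>)\<^sup>2)"
      "expectation (\<lambda>\<omega>. (black_scholes W s0 \<sigma> r t \<omega>)\<^sup>2) \<le> B" if "0 < t" "t \<le> T" for t
  proof -
    have "(2 * r + \<sigma>\<^sup>2) * t \<le> (2 * \<bar>r\<bar> + \<sigma>\<^sup>2) * T"
      using that by (intro order_trans[OF mult_right_mono mult_left_mono]) auto
    then show "integrable M (\<lambda>\<omega>. (black_scholes W s0 \<sigma> r t \<omega>)\<^sup>2)"
      "expectation (\<lambda>\<omega>. (black_scholes W s0 \<sigma> r t \<omega>)\<^sup>2) \<le> B"
      using second_moment_black_scholes[OF that(1) \<open>0 < \<sigma>\<close>, of s0 r]
      by (auto simp: has_bochner_integral_iff B_def intro!: mult_left_mono)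
  qed
  \<comment> \<open>The mean of the squared prices dominates the square of their mean
    \<open>A n\<close> by Cauchy-Schwarz, and its expectation is at most \<open>B\<close>.\<close>
  define Q where "Q n \<omega> = (\<Sum>k<Suc n. (black_scholes W s0 \<sigma> r (Suc k * (T / Suc n)) \<omega>)\<^sup>2) / Suc n" for n \<omega>
  \<comment> \<open>Right endpoints keep every sampling time strictly positive, as the second moment
    formula requires.\<close>
  have time: "0 < Suc k * (T / Suc n)" "Suc k * (T / Suc n) \<le> T" if "k < Suc n" for k n
    using that \<open>0 < T\<close> by (auto simp: field_simps add_pos_nonneg)
  have Q_int: "integrable M (Q n)" for n
    unfolding Q_def
    by (intro Bochner_Integration.integrable_divide Bochner_Integration.integrable_sum moment time) auto
  have Q_le: "expectation (Q n) \<le> B" for n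
  proof -
    have "expectation (Q n)
        = (\<Sum>k<Suc n. expectation (\<lambda>\<omega>. (black_scholes W s0 \<sigma> r (Suc k * (T / Suc n)) \<omega>)\<^sup>2)) / Suc n"
      unfolding Q_def Bochner_Integration.integral_divide_zero
      by (subst Bochner_Integration.integral_sum) (auto intro!: moment time simp del: of_nat_Suc times_divide_eq_right)
    also have "\<dots> \<le> (\<Sum>k<Suc n. B) / Suc n"
      by (intro divide_right_mono sum_mono moment time) auto
    also have "\<dots> = B" by (simp del: sum.lessThan_Suc of_nat_Suc)
    finally show ?thesis .
  qed
  have dom: "(\<phi> (A n \<omega>))\<^sup>2 \<le> 2 * C\<^sup>2 * (1 + Q n \<omega>)" for n \<omega>
  proof -
    have "(A n \<omega>)\<^sup>2 \<le> Q n \<omega>"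
    proof -
      have "(\<Sum>k<Suc n. black_scholes W s0 \<sigma> r (Suc k * (T / Suc n)) \<omega>)\<^sup>2
        \<le> (\<Sum>k<Suc n. (black_scholes W s0 \<sigma> r (Suc k * (T / Suc n)) \<omega>)\<^sup>2) * card {..<Suc n}"
        by (rule sum_squared_le_sum_of_squares)
      then show ?thesis
        unfolding A_def Q_def power_divide
        by (simp add: divide_simps power2_eq_square del: sum.lessThan_Suc of_nat_Suc)
    qed
    moreover have "(\<phi> (A n \<omega>))\<^sup>2 \<le> (C * (1 + \<bar>A n \<omega>\<bar>))\<^sup>2"
      using C(2)[of "A n \<omega>"] by (intro power2_le_iff_abs_le[THEN iffD2] order_trans[OF _ C(2)]) auto
    \<comment> \<open>From \<open>2 * x \<le> 1 + x^2\<close> with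
      \<open>x = \<bar>A n \<omega>\<bar>\<close>; this is the source of the factor 2 in the
      bound.\<close>
    moreover have "(1 + \<bar>A n \<omega>\<bar>)\<^sup>2 \<le> 2 * (1 + (A n \<omega>)\<^sup>2)"
      using sum_squares_bound[of 1 "\<bar>A n \<omega>\<bar>"] by (simp add: power2_sum)
    then have "(C * (1 + \<bar>A n \<omega>\<bar>))\<^sup>2 \<le> C\<^sup>2 * (2 * (1 + (A n \<omega>)\<^sup>2))"
      unfolding power_mult_distrib by (intro mult_left_mono) auto
    moreover have "C\<^sup>2 * (2 * (1 + (A n \<omega>)\<^sup>2)) \<le> C\<^sup>2 * (2 * (1 + Q n \<omega>))"
      using calculation(1) by (intro mult_left_mono) auto
    ultimately have "(\<phi> (A n \<omega>))\<^sup>2 \<le> C\<^sup>2 * (2 * (1 + Q n \<omega>))" by linarith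
    then show ?thesis by (simp add: algebra_simps)
  qed
  have dom_int: "integrable M (\<lambda>\<omega>. 2 * C\<^sup>2 * (1 + Q n \<omega>))" for n
    using Q_int by simp
  have sq_int: "integrable M (\<lambda>\<omega>. (\<phi> (A n \<omega>))\<^sup>2)" for n
    using dom_int[of n] by (rule Bochner_Integration.integrable_bound)
      (use dom in \<open>auto intro: order_trans[OF _ abs_ge_self]\<close>)
  have "(\<lambda>n. expectation (\<lambda>\<omega>. \<phi> (A n \<omega>)))
    \<longlonglongrightarrow> expectation (\<lambda>\<omega>. \<phi> (1 / T * (LBINT s:{0..T}. black_scholes W s0 \<sigma> r s \<omega>)))"
  proof (rule tendsto_integral_L2_bounded[OF prob_space_axioms])
    fix \<omega> assume "\<omega> \<in> space M"
    have "isCont \<phi> x" for x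
      using convex_on_continuous[OF open_UNIV convex] by (simp add: continuous_on_eq_continuous_at)
    then show "(\<lambda>n. \<phi> (A n \<omega>)) \<longlonglongrightarrow> \<phi> (1 / T * (LBINT s:{0..T}. black_scholes W s0 \<sigma> r s \<omega>))"
      unfolding A_def
      by (rule isCont_tendsto_compose) (rule black_scholes_average_tendsto[OF \<open>0 < T\<close> \<open>\<omega> \<in> space M\<close>])
  next
    fix n
    have "expectation (\<lambda>\<omega>. (\<phi> (A n \<omega>))\<^sup>2) \<le> expectation (\<lambda>\<omega>. 2 * C\<^sup>2 * (1 + Q n \<omega>))"
      using dom by (intro integral_mono sq_int dom_int) auto
    also have "\<dots> = 2 * C\<^sup>2 * (1 + expectation (Q n))"
      using Q_int[of n] by (simp add: prob_space)
    also have "\<dots> \<le> 2 * C\<^sup>2 * (1 + B)"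
      using Q_le[of n] by (intro mult_left_mono) auto
    finally show "expectation (\<lambda>\<omega>. (\<phi> (A n \<omega>))\<^sup>2) \<le> 2 * C\<^sup>2 * (1 + B)" .
  qed (use nonneg sq_int in auto)
  from tendsto_mult_left[OF this, of "exp (- r * T)"] show ?thesis
    unfolding premium_def A_def
    using \<open>0 < T\<close> \<open>0 < \<sigma>\<close>
    by (subst (asm) expectation_black_scholes_average[OF \<phi>_meas]) auto
qed

end

section \<open>Passage to the limit: monotonicity in volatility and in maturity\<close>

theorem mainTheorem17:
  fixes M :: "'a measure" and W :: "real \<Rightarrow> 'a \<Rightarrow> real"
    and \<phi> :: "real \<Rightarrow> real" and s0 r :: real
  assumes "standard_brownian_motion M W"
    and "\<And>x. 0 \<le> \<phi> x"
    and "convex_on UNIV \<phi>"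
    and "linear_growth \<phi>"
    and "0 < s0"
  shows "(\<forall>T>0. mono_on {0<..} (\<lambda>\<sigma>. premium M W \<phi> s0 \<sigma> r T)) \<and>
         (\<forall>\<sigma>>0. mono_on {0<..} (\<lambda>T. premium M W \<phi> s0 \<sigma> 0 T))"
proof (intro conjI allI impI mono_onI)
  interpret standard_brownian_motion M W by fact
  note lim = premium_tendsto[OF assms(2-4)]
  fix T \<sigma>1 \<sigma>2 :: real
  assume *: "0 < T" "\<sigma>1 \<in> {0<..}" "\<sigma>2 \<in> {0<..}" "\<sigma>1 \<le> \<sigma>2"
  show "premium M W \<phi> s0 \<sigma>1 r T \<le> premium M W \<phi> s0 \<sigma>2 r T"
    \<comment> \<open>For fixed \<open>T\<close> both approximating sequences have the same discount
      factor and coefficients; they differ only in the variance, which increases with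
      \<sigma>.\<close>
    using * by (intro LIMSEQ_le[OF lim lim] exI[of _ 0] allI impI mult_left_mono
        basket_premium_mono[OF assms(3,4)] mult_right_mono power_mono) auto
next
  interpret standard_brownian_motion M W by fact
  \<comment> \<open>At \<open>r = 0\<close> the discount factor and the exponentials in the
    coefficients become 1, leaving \<open>T\<close> only in the variance
    \<open>\<sigma>^2 * (T / Suc n)\<close>.\<close>
  note lim = premium_tendsto[OF assms(2-4), where r = 0, simplified mult_zero_left minus_zero exp_zero mult_1_left mult_1_right]
  fix \<sigma> T1 T2 :: real
  assume *: "0 < \<sigma>" "T1 \<in> {0<..}" "T2 \<in> {0<..}" "T1 \<le> T2"
  show "premium M W \<phi> s0 \<sigma> 0 T1 \<le> premium M W \<phi> s0 \<sigma> 0 T2"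
    using * by (intro LIMSEQ_le[OF lim lim] exI[of _ 0] allI impI
        basket_premium_mono[OF assms(3,4)] mult_left_mono divide_right_mono) auto
qed

end
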